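(* Let $b$ be a prime, $d\in\mathbb{N}$, let $\{\boldsymbol z_i\}_{i=0}^\infty\subset[0,1)^d$ be a digital sequence in base $b$, let $\boldsymbol\Delta\in[0,1)^d$ be a digital shift with $\mathrm{ok}(\boldsymbol z_i,\boldsymbol\Delta)=$ true for all $i\in\mathbb{N}_0$, and let $\tilde{\boldsymbol k}:\mathbb{N}_0\to\mathbb{N}_0^d$ be a wavenumber map for this digital sequence. Let $\ell_*\in\mathbb{N}$ and let $\hat\omega,\mathring\omega:\mathbb{N}_0\to[0,\infty)$ satisfy $\lim_{m\to\infty}\mathring\omega(m)=0$ and $\hat\omega(r)\mathring\omega(r)<1$ for some $r\in\mathbb{N}$. Let $\mathcal{C}$ be the cone of integrands determined by $\ell_*,\hat\omega,\mathring\omega$ (defined in the context). Then for every $f\in\mathcal{C}$ and all $\ell,m\in\mathbb{N}$ with $\ell_*\le\ell\le m$ and $\hat\omega(m-\ell)\mathring\omega(m-\ell)<1$, $$\Bigl|\int_{[0,1)^d}f(\boldsymbol x)\,d\boldsymbol x-\hat I_m(f)\Bigr|\le\frac{\widetilde S_{\ell,m}(f)\,\hat\omega(m)\,\mathring\omega(m-\ell)}{1-\hat\omega(m-\ell)\mathring\omega(m-\ell)} .$$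
   Context: **Digitwise arithmetic.** Let $b$ be prime, $\mathbb{F}_b=\{0,\dots,b-1\}$ (the field of integers mod $b$). For $\boldsymbol x,\boldsymbol t\in[0,1)^d$ write the proper $b$-ary expansions (not ending in an infinite trail of digits $b-1$) $\boldsymbol x=(\sum_{\ell\ge1}x_{j\ell}b^{-\ell})_{j=1}^d$, $\boldsymbol t=(\sum_{\ell\ge1}t_{j\ell}b^{-\ell})_{j=1}^d$. Define $\boldsymbol x\oplus\boldsymbol t=(\sum_{\ell\ge1}[(x_{j\ell}+t_{j\ell})\bmod b]b^{-\ell}\pmod 1)_{j=1}^d$, $\ominus\boldsymbol x=(\sum_{\ell\ge1}[-x_{j\ell}\bmod b]b^{-\ell})_{j=1}^d$, and for $a\in\mathbb{F}_b$, $a\boldsymbol x=\boldsymbol x\oplus\cdots\oplus\boldsymbol x$ ($a$ times; $\boldsymbol 0$ if $a=0$). Define $\mathrm{ok}(\boldsymbol x,\boldsymbol t)=$ true iff for every $j=1,\dots,d$ there are infinitely many $\ell$ with $(x_{j\ell}+t_{j\ell})\bmod b\ne b-1$. For $\boldsymbol k=(\sum_{\ell\ge0}k_{j\ell}b^\ell)_{j}$, $\boldsymbol l=(\sum_{\ell\ge0}l_{j\ell}b^\ell)_{j}$ in $\mathbb{N}_0^d$ (digits in $\mathbb{F}_b$), $\boldsymbol k\oplus\boldsymbol l=(\sum_\ell[(k_{j\ell}+l_{j\ell})\bmod b]b^\ell)_j$, $\ominus\boldsymbol k=(\sum_\ell[-k_{j\ell}\bmod b]b^\ell)_j$, $\boldsymbol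 k\ominus\boldsymbol l=\boldsymbol k\oplus(\ominus\boldsymbol l)$. **Pairing.** $\langle\boldsymbol k,\boldsymbol x\rangle=\sum_{j=1}^d\sum_{\ell\ge0}k_{j\ell}x_{j,\ell+1}\pmod b\in\mathbb{F}_b$ for $\boldsymbol k\in\mathbb{N}_0^d$, $\boldsymbol x\in[0,1)^d$. **Digital sequence.** A sequence $\{\boldsymbol z_i\}_{i=0}^\infty\subset[0,1)^d$ whose set of points $\mathcal{P}_\infty$ is closed under $\oplus$ with $\mathrm{ok}(\boldsymbol x,\boldsymbol t)$ true for all $\boldsymbol x,\boldsymbol t\in\mathcal{P}_\infty$ (hence $\mathcal{P}_\infty$ is an $\mathbb{F}_b$-vector space), such that $\boldsymbol z_1,\boldsymbol z_b,\boldsymbol z_{b^2},\dots$ are linearly independent over $\mathbb{F}_b$ and $\boldsymbol z_i=\bigoplus_{\ell\ge0} i_\ell\boldsymbol z_{b^\ell}$ whenever $i=\sum_{\ell\ge0} i_\ell b^\ell$ with $i_\ell\in\mathbb{F}_b$. It is also assumed that $\langle\boldsymbol k,\boldsymbol z_i\rangle=0$ for all $i\in\mathbb{N}_0$ implies $\boldsymbol k=\boldsymbol 0$. For $m\in\mathbb{N}_0$ the dual net is $\mathcal{P}_m^\perp=\{\boldsymbol k\in\mathbb{N}_0^d:\langle\boldsymbol k,\boldsymbol z_i\rangle=0,\ i=0,\dots,b^m-1\}$. **Wavenumber map.** A map $\tilde{\boldsymbol k}$ from $\mathbb{N}_0$ onto $\mathbb{N}_0^d$ such that $\tilde{\boldsymbol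 k}(0)=\boldsymbol 0$ and, for every $m\in\mathbb{N}_0$ and $\kappa\in\{0,\dots,b^m-1\}$, the values $\tilde{\boldsymbol k}(\kappa+b^m),\dots,\tilde{\boldsymbol k}(\kappa+(b-1)b^m)$ are chosen, one from each and in some order, from the $b-1$ sets $\{\boldsymbol k:\boldsymbol k\ominus\tilde{\boldsymbol k}(\kappa)\in\mathcal{P}_m^\perp,\ \langle\boldsymbol k\ominus\tilde{\boldsymbol k}(\kappa),\boldsymbol z_{b^m}\rangle=a\}$, $a=1,\dots,b-1$. **Walsh coefficients.** For $f\in L^2([0,1)^d)$, $\hat f(\boldsymbol k)=\int_{[0,1)^d}f(\boldsymbol x)e^{-2\pi\sqrt{-1}\langle\boldsymbol k,\boldsymbol x\rangle/b}\,d\boldsymbol x$. Integrands are identified with their Walsh series: $f(\boldsymbol x)=\sum_{\boldsymbol k\in\mathbb{N}_0^d}\hat f(\boldsymbol k)e^{2\pi\sqrt{-1}\langle\boldsymbol k,\boldsymbol x\rangle/b}$, this equality being assumed to hold at the sampled points. Put $\hat I_m(f)=b^{-m}\sum_{i=0}^{b^m-1}f(\boldsymbol z_i\oplus\boldsymbol\Delta)$ and let the discrete Walsh transform be $\tilde f_m(\boldsymbol k)=b^{-m}\sum_{i=0}^{b^m-1}e^{-2\pi\sqrt{-1}\langle\boldsymbol k,\boldsymbol z_i\oplus\boldsymbol\Delta\rangle/b}f(\boldsymbol z_i\oplus\boldsymbol\Delta)$. Write $\hat f_\kappa=\hat f(\tilde{\boldsymbol k}(\kappa))$, $\tilde f_{m,\kappa}=\tilde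 f_m(\tilde{\boldsymbol k}(\kappa))$. **Sums.** For $\ell,m\in\mathbb{N}_0$, $\ell\le m$: $S_m(f)=\sum_{\kappa=\lfloor b^{m-1}\rfloor}^{b^m-1}|\hat f_\kappa|$, $\ \widehat S_{\ell,m}(f)=\sum_{\kappa=\lfloor b^{\ell-1}\rfloor}^{b^\ell-1}\sum_{\lambda=1}^\infty|\hat f_{\kappa+\lambda b^m}|$, $\ \check S_m(f)=\sum_{\kappa=b^m}^\infty|\hat f_\kappa|$, $\ \widetilde S_{\ell,m}(f)=\sum_{\kappa=\lfloor b^{\ell-1}\rfloor}^{b^\ell-1}|\tilde f_{m,\kappa}|$. **Cone.** $\mathcal{C}$ is the set of $f\in L^2([0,1)^d)$ such that $\widehat S_{\ell,m}(f)\le\hat\omega(m-\ell)\check S_m(f)$ for all $\ell\le m$, and $\check S_m(f)\le\mathring\omega(m-\ell)S_\ell(f)$ for all $\ell_*\le\ell\le m$. *)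

theory Defs
  imports "HOL-Analysis.Analysis" "HOL-Computational_Algebra.Primes"
begin

text \<open>The dimension \<open>d\<close> is the cardinality of the finite index type \<open>'d\<close>. The field
  of integers modulo \<open>b\<close> is represented by the naturals below \<open>b\<close>.\<close>

definition half_open_cube :: "(real ^ 'd) set" where
  "half_open_cube = {x. \<forall>j. 0 \<le> x $ j \<and> x $ j < 1}"

text \<open>\<open>rdigit b x l\<close> is the coefficient of \<open>b ^ (- l)\<close>, for \<open>l \<ge> 1\<close>, in the proper
  expansion of \<open>x \<in> [0,1)\<close>; see \<open>rdigit_proper_expansion\<close>.\<close>

definition rdigit :: "nat \<Rightarrow> real \<Rightarrow> nat \<Rightarrow> nat" where
  "rdigit b x l = nat \<lfloor>x * real b ^ l\<rfloor> mod b"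

lemma rdigit_partial_sum:
  assumes b: "b \<ge> 2" and x: "0 \<le> x" "x < 1"
  shows "(\<Sum>l<n. real (rdigit b x (Suc l)) / real b ^ Suc l) = real_of_int \<lfloor>x * real b ^ n\<rfloor> / real b ^ n"
proof (induction n)
  case 0
  have "\<lfloor>x\<rfloor> = 0" using x by (simp add: floor_eq_iff)
  then show ?case by simp
next
  case (Suc n)
  have b0: "real b > 0" using b by simp
  define y where "y = x * real b ^ Suc n"
  have y0: "y \<ge> 0" using x b0 by (simp add: y_def)
  have "\<lfloor>y / of_nat b\<rfloor> = \<lfloor>y\<rfloor> div int b"
    using floor_divide_real_eq_div[of "int b" y] by simp
  moreover have "y / real b = x * real b ^ n" using b0 by (simp add: y_def)
  ultimately have fl: "\<lfloor>x * real b ^ n\<rfloor> = \<lfloor>y\<rfloor> div int b" by simp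
  have "int (rdigit b x (Suc n)) = \<lfloor>y\<rfloor> mod int b"
    using y0 unfolding rdigit_def y_def[symmetric] by (simp add: zmod_int)
  then have "\<lfloor>y\<rfloor> = int b * \<lfloor>x * real b ^ n\<rfloor> + int (rdigit b x (Suc n))"
    using fl by simp
  then have "real_of_int \<lfloor>y\<rfloor> = real b * real_of_int \<lfloor>x * real b ^ n\<rfloor> + real (rdigit b x (Suc n))"
    by (metis of_int_add of_int_mult of_int_of_nat_eq)
  then show ?case using Suc b0 unfolding y_def by (simp add: field_simps)
qed

lemma rdigit_proper_expansion:
  assumes b: "b \<ge> 2" and x: "0 \<le> x" "x < 1"
  shows "\<And>l. rdigit b x l < b"
    and "(\<lambda>l. real (rdigit b x (Suc l)) / real b ^ Suc l) sums x"
    and "infinite {l. l \<ge> 1 \<and> rdigit b x l \<noteq> b - 1}"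
proof -
  have b1: "real b > 1" using b by simp
  show dl: "rdigit b x l < b" for l using b by (simp add: rdigit_def)
  have lim0: "(\<lambda>n. 1 / real b ^ n) \<longlonglongrightarrow> 0"
    using LIMSEQ_inverse_realpow_zero[OF b1] by (simp add: inverse_eq_divide)
  have "(\<lambda>n. real_of_int \<lfloor>x * real b ^ n\<rfloor> / real b ^ n) \<longlonglongrightarrow> x"
  proof (rule real_tendsto_sandwich[where f = "\<lambda>n. x - 1 / real b ^ n" and h = "\<lambda>_. x"])
    show "\<forall>\<^sub>F n in sequentially. x - 1 / real b ^ n \<le> real_of_int \<lfloor>x * real b ^ n\<rfloor> / real b ^ n"
    proof (intro always_eventually allI)
      fix n
      have "x * real b ^ n - 1 \<le> real_of_int \<lfloor>x * real b ^ n\<rfloor>" by linarith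
      then have "(x * real b ^ n - 1) / real b ^ n \<le> real_of_int \<lfloor>x * real b ^ n\<rfloor> / real b ^ n"
        using b1 by (intro divide_right_mono) auto
      then show "x - 1 / real b ^ n \<le> real_of_int \<lfloor>x * real b ^ n\<rfloor> / real b ^ n"
        using b1 by (simp add: diff_divide_distrib)
    qed
    show "\<forall>\<^sub>F n in sequentially. real_of_int \<lfloor>x * real b ^ n\<rfloor> / real b ^ n \<le> x"
      using b1 by (intro always_eventually allI) (simp add: pos_divide_le_eq)
    show "(\<lambda>n. x - 1 / real b ^ n) \<longlonglongrightarrow> x"
      using tendsto_diff[OF tendsto_const[of x] lim0] by simp
  qed simp
  then show "(\<lambda>l. real (rdigit b x (Suc l)) / real b ^ Suc l) sums x"
    unfolding sums_def rdigit_partial_sum[OF b x] .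
  show "infinite {l. l \<ge> 1 \<and> rdigit b x l \<noteq> b - 1}"
  proof
    assume "finite {l. l \<ge> 1 \<and> rdigit b x l \<noteq> b - 1}"
    then obtain N where "\<forall>l\<in>{l. l \<ge> 1 \<and> rdigit b x l \<noteq> b - 1}. l \<le> N"
      using finite_nat_set_iff_bounded_le by blast
    then have N: "rdigit b x (Suc l) = b - 1" if "l \<ge> N" for l
      using that by force
    have rb: "real (b - 1) = real b - 1" using b by simp
    define c where "c = real_of_int \<lfloor>x * real b ^ N\<rfloor> / real b ^ N + 1 / real b ^ N"
    have ps: "real_of_int \<lfloor>x * real b ^ n\<rfloor> / real b ^ n = c - 1 / real b ^ n" if "n \<ge> N" for n
      using that
    proof (induction n rule: dec_induct)
      case base
      show ?case by (simp add: c_def)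
    next
      case (step n)
      have "real_of_int \<lfloor>x * real b ^ Suc n\<rfloor> / real b ^ Suc n
          = real_of_int \<lfloor>x * real b ^ n\<rfloor> / real b ^ n + (real b - 1) / real b ^ Suc n"
        using rdigit_partial_sum[OF b x, of "Suc n"] rdigit_partial_sum[OF b x, of n]
          N[OF step.hyps(1)] rb by simp
      also have "\<dots> = c - 1 / real b ^ n + (real b - 1) / real b ^ Suc n" using step by simp
      also have "\<dots> = c - 1 / real b ^ Suc n" using b1 by (simp add: field_simps)
      finally show ?case .
    qed
    have "(\<lambda>n. c - 1 / real b ^ n) \<longlonglongrightarrow> c"
      using tendsto_diff[OF tendsto_const[of c] lim0] by simp
    moreover have "\<forall>\<^sub>F n in sequentially. c - 1 / real b ^ n = real_of_int \<lfloor>x * real b ^ n\<rfloor> / real b ^ n"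
      unfolding eventually_sequentially using ps by (intro exI[of _ N]) simp
    ultimately have "(\<lambda>n. real_of_int \<lfloor>x * real b ^ n\<rfloor> / real b ^ n) \<longlonglongrightarrow> c"
      by (rule Lim_transform_eventually)
    then have "x = c"
      using \<open>(\<lambda>n. real_of_int \<lfloor>x * real b ^ n\<rfloor> / real b ^ n) \<longlonglongrightarrow> x\<close> LIMSEQ_unique by blast
    then have "x * real b ^ N = real_of_int \<lfloor>x * real b ^ N\<rfloor> + 1"
      using b1 by (simp add: c_def field_simps)
    then show False by linarith
  qed
qed

definition ndigit :: "nat \<Rightarrow> nat \<Rightarrow> nat \<Rightarrow> nat" where
  "ndigit b k l = (k div b ^ l) mod b"

definition dplus :: "nat \<Rightarrow> real ^ 'd \<Rightarrow> real ^ 'd \<Rightarrow> real ^ 'd" where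
  "dplus b x t = (\<chi> j. frac (\<Sum>l.
     real ((rdigit b (x $ j) (Suc l) + rdigit b (t $ j) (Suc l)) mod b) / real b ^ Suc l))"

definition dscale :: "nat \<Rightarrow> nat \<Rightarrow> real ^ 'd \<Rightarrow> real ^ 'd" where
  "dscale b a x = ((dplus b x) ^^ a) 0"

text \<open>Digitwise sum of \<open>v 0, \<dots>, v (n - 1)\<close>.\<close>

primrec dsum :: "nat \<Rightarrow> (nat \<Rightarrow> real ^ 'd) \<Rightarrow> nat \<Rightarrow> real ^ 'd" where
  "dsum b v 0 = 0"
| "dsum b v (Suc n) = dplus b (dsum b v n) (v n)"

definition ok :: "nat \<Rightarrow> real ^ 'd \<Rightarrow> real ^ 'd \<Rightarrow> bool" where
  "ok b x t \<longleftrightarrow>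
     (\<forall>j. infinite {l. l \<ge> 1 \<and> (rdigit b (x $ j) l + rdigit b (t $ j) l) mod b \<noteq> b - 1})"

text \<open>For \<open>b \<ge> 2\<close> the series of naturals below have only finitely many nonzero terms.\<close>

definition nplus :: "nat \<Rightarrow> nat ^ 'd \<Rightarrow> nat ^ 'd \<Rightarrow> nat ^ 'd" where
  "nplus b k k' = (\<chi> j. \<Sum>l. ((ndigit b (k $ j) l + ndigit b (k' $ j) l) mod b) * b ^ l)"

definition nneg :: "nat \<Rightarrow> nat ^ 'd \<Rightarrow> nat ^ 'd" where
  "nneg b k = (\<chi> j. \<Sum>l. ((b - ndigit b (k $ j) l) mod b) * b ^ l)"

definition nminus :: "nat \<Rightarrow> nat ^ 'd \<Rightarrow> nat ^ 'd \<Rightarrow> nat ^ 'd" where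
  "nminus b k k' = nplus b k (nneg b k')"

definition pairing :: "nat \<Rightarrow> nat ^ 'd \<Rightarrow> real ^ 'd \<Rightarrow> nat" where
  "pairing b k x = (\<Sum>j\<in>UNIV. \<Sum>l. ndigit b (k $ j) l * rdigit b (x $ j) (Suc l)) mod b"

definition digital_sequence :: "nat \<Rightarrow> (nat \<Rightarrow> real ^ 'd) \<Rightarrow> bool" where
  "digital_sequence b z \<longleftrightarrow>
     range z \<subseteq> half_open_cube \<and>
     (\<forall>x\<in>range z. \<forall>t\<in>range z. dplus b x t \<in> range z \<and> ok b x t) \<and>
     (\<forall>n c. (\<forall>l<n. c l < b) \<and> dsum b (\<lambda>l. dscale b (c l) (z (b ^ l))) n = 0
        \<longrightarrow> (\<forall>l<n. c l = 0)) \<and>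
     (\<forall>n. \<forall>i<b ^ n. z i = dsum b (\<lambda>l. dscale b (ndigit b i l) (z (b ^ l))) n) \<and>
     (\<forall>k. (\<forall>i. pairing b k (z i) = 0) \<longrightarrow> k = 0)"

definition dual_net :: "nat \<Rightarrow> (nat \<Rightarrow> real ^ 'd) \<Rightarrow> nat \<Rightarrow> (nat ^ 'd) set" where
  "dual_net b z m = {k. \<forall>i<b ^ m. pairing b k (z i) = 0}"

text \<open>The permutation \<open>\<sigma>\<close> records the order in which the \<open>b - 1\<close> sets are used.\<close>

definition wavenumber_map ::
  "nat \<Rightarrow> (nat \<Rightarrow> real ^ 'd) \<Rightarrow> (nat \<Rightarrow> nat ^ 'd) \<Rightarrow> bool" where
  "wavenumber_map b z kt \<longleftrightarrow>
     surj kt \<and> kt 0 = 0 \<and>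
     (\<forall>m. \<forall>\<kappa><b ^ m. \<exists>\<sigma>. bij_betw \<sigma> {1..<b} {1..<b} \<and>
        (\<forall>a\<in>{1..<b}. kt (\<kappa> + a * b ^ m) \<in>
           {k. nminus b k (kt \<kappa>) \<in> dual_net b z m \<and>
               pairing b (nminus b k (kt \<kappa>)) (z (b ^ m)) = \<sigma> a}))"

definition square_integrable :: "(real ^ 'd \<Rightarrow> complex) set" where
  "square_integrable = {f. f \<in> borel_measurable (lebesgue_on half_open_cube) \<and>
     integrable (lebesgue_on half_open_cube) (\<lambda>x. (cmod (f x))\<^sup>2)}"

definition walsh :: "nat \<Rightarrow> nat ^ 'd \<Rightarrow> real ^ 'd \<Rightarrow> complex" where
  "walsh b k x = exp (2 * of_real pi * \<i> * of_nat (pairing b k x) / of_nat b)"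

definition walsh_coeff :: "nat \<Rightarrow> (real ^ 'd \<Rightarrow> complex) \<Rightarrow> nat ^ 'd \<Rightarrow> complex" where
  "walsh_coeff b f k = (LINT x|lebesgue_on half_open_cube.
     f x * exp (- 2 * of_real pi * \<i> * of_nat (pairing b k x) / of_nat b))"

definition cubature ::
  "nat \<Rightarrow> (nat \<Rightarrow> real ^ 'd) \<Rightarrow> real ^ 'd \<Rightarrow> (real ^ 'd \<Rightarrow> complex) \<Rightarrow> nat \<Rightarrow> complex" where
  "cubature b z \<Delta> f m = (\<Sum>i<b ^ m. f (dplus b (z i) \<Delta>)) / of_nat (b ^ m)"

definition discrete_walsh ::
  "nat \<Rightarrow> (nat \<Rightarrow> real ^ 'd) \<Rightarrow> real ^ 'd \<Rightarrow> (real ^ 'd \<Rightarrow> complex) \<Rightarrow> nat \<Rightarrow> nat ^ 'd \<Rightarrow> complex" where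
  "discrete_walsh b z \<Delta> f m k =
     (\<Sum>i<b ^ m. exp (- 2 * of_real pi * \<i> * of_nat (pairing b k (dplus b (z i) \<Delta>)) / of_nat b)
        * f (dplus b (z i) \<Delta>)) / of_nat (b ^ m)"

text \<open>The lower summation limit \<open>\<lfloor>b ^ (m - 1)\<rfloor>\<close>, which is \<open>0\<close> for \<open>m = 0\<close>, is
  \<open>b ^ m div b\<close>. The two infinite sums take values in \<^typ>\<open>ennreal\<close>, so that
  the cone conditions include the convergence of these sums.\<close>

definition S_sum ::
  "nat \<Rightarrow> (nat \<Rightarrow> nat ^ 'd) \<Rightarrow> (real ^ 'd \<Rightarrow> complex) \<Rightarrow> nat \<Rightarrow> real" where
  "S_sum b kt f m = (\<Sum>\<kappa>\<in>{b ^ m div b..<b ^ m}. cmod (walsh_coeff b f (kt \<kappa>)))"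

definition S_hat ::
  "nat \<Rightarrow> (nat \<Rightarrow> nat ^ 'd) \<Rightarrow> (real ^ 'd \<Rightarrow> complex) \<Rightarrow> nat \<Rightarrow> nat \<Rightarrow> ennreal" where
  "S_hat b kt f l m = (\<Sum>\<kappa>\<in>{b ^ l div b..<b ^ l}.
     \<Sum>n. ennreal (cmod (walsh_coeff b f (kt (\<kappa> + Suc n * b ^ m)))))"

definition S_check ::
  "nat \<Rightarrow> (nat \<Rightarrow> nat ^ 'd) \<Rightarrow> (real ^ 'd \<Rightarrow> complex) \<Rightarrow> nat \<Rightarrow> ennreal" where
  "S_check b kt f m = (\<Sum>n. ennreal (cmod (walsh_coeff b f (kt (b ^ m + n)))))"

definition S_tilde ::
  "nat \<Rightarrow> (nat \<Rightarrow> real ^ 'd) \<Rightarrow> real ^ 'd \<Rightarrow> (nat \<Rightarrow> nat ^ 'd) \<Rightarrow> (real ^ 'd \<Rightarrow> complex)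
     \<Rightarrow> nat \<Rightarrow> nat \<Rightarrow> real" where
  "S_tilde b z \<Delta> kt f l m =
     (\<Sum>\<kappa>\<in>{b ^ l div b..<b ^ l}. cmod (discrete_walsh b z \<Delta> f m (kt \<kappa>)))"

definition integrand_cone ::
  "nat \<Rightarrow> (nat \<Rightarrow> nat ^ 'd) \<Rightarrow> nat \<Rightarrow> (nat \<Rightarrow> real) \<Rightarrow> (nat \<Rightarrow> real)
     \<Rightarrow> (real ^ 'd \<Rightarrow> complex) set" where
  "integrand_cone b kt l_star \<omega>hat \<omega>ring = {f \<in> square_integrable.
     (\<forall>l m. l \<le> m \<longrightarrow> S_hat b kt f l m \<le> ennreal (\<omega>hat (m - l)) * S_check b kt f m) \<and>
     (\<forall>l m. l_star \<le> l \<and> l \<le> m \<longrightarrow>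
        S_check b kt f m \<le> ennreal (\<omega>ring (m - l)) * ennreal (S_sum b kt f l))}"

end

(* Averaging the Walsh series of f over the shifted net annihilates every character outside the
   coset of the dual net, so the discrete coefficient differs from the true one only by its aliases,
   and the wavenumber map is built so that the aliases of kt kappa are exactly the
   kt (kappa + lambda * b ^ m) with lambda >= 1.
   For kappa = 0 this bounds the cubature error by S_hat 0 m, hence by
   omega_hat m * omega_ring (m - l) * S l. For kappa in block l it gives
   S l <= S_tilde l m + S_hat l m <= S_tilde l m + omega_hat (m - l) * omega_ring (m - l) * S l,
   which is solved for S l. *)
theory Submission
  imports Defs "HOL-Number_Theory.Cong"
begin

section \<open>Digits\<close>

lemma ndigit_less: "b > 0 \<Longrightarrow> ndigit b k l < b"
  by (simp add: ndigit_def)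

text \<open>The crude bound \<open>k < b ^ k\<close> is enough: it truncates every digit series of
  \<open>k\<close> after \<open>k\<close> terms.\<close>

lemma ndigit_eq_0:
  assumes "b \<ge> 2" "k \<le> l"
  shows "ndigit b k l = 0"
proof -
  have "k < 2 ^ k" by (rule less_exp)
  also have "\<dots> \<le> b ^ k" using assms by (intro power_mono) auto
  also have "\<dots> \<le> b ^ l" using assms by (intro power_increasing) auto
  finally show ?thesis by (simp add: ndigit_def)
qed

text \<open>Uniqueness of base-\<open>b\<close> digits. Peeling off the lowest digit leaves a sum of
  the same kind for the shifted digits, so the induction varies both \<open>c\<close> and
  \<open>i\<close>.\<close>

lemma ndigit_sum:
  assumes "\<And>l. c l < b"
  shows "ndigit b (\<Sum>l<N. c l * b ^ l) i = (if i < N then c i else 0)"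
  using assms
proof (induction N arbitrary: c i)
  case 0
  then show ?case by (simp add: ndigit_def)
next
  case (Suc N)
  have b0: "b > 0" using Suc.prems[of 0] by simp
  define M where "M = (\<Sum>l<N. c (Suc l) * b ^ l)"
  have eq: "(\<Sum>l<Suc N. c l * b ^ l) = c 0 + b * M"
    unfolding sum.lessThan_Suc_shift M_def by (simp add: sum_distrib_left ac_simps)
  show ?case
  proof (cases i)
    case 0
    then show ?thesis unfolding eq using Suc.prems[of 0] by (simp add: ndigit_def)
  next
    case (Suc j)
    have "ndigit b (c 0 + b * M) i = ndigit b M j"
      using Suc b0 Suc.prems[of 0] by (simp add: ndigit_def div_mult2_eq)
    then show ?thesis
      unfolding eq using Suc.IH[of "\<lambda>l. c (Suc l)" j] Suc.prems Suc by (simp add: M_def)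
  qed
qed

lemma ndigit_add_power:
  assumes "i < b ^ m" "a < b"
  shows "l < m \<Longrightarrow> ndigit b (i + a * b ^ m) l = ndigit b i l"
    and "ndigit b (i + a * b ^ m) m = a"
proof -
  have b0: "b > 0" using assms by simp
  show "ndigit b (i + a * b ^ m) m = a"
    using assms b0 by (simp add: ndigit_def)
  assume l: "l < m"
  then have "b ^ m = b ^ l * (b * b ^ (m - Suc l))"
    by (metis Suc_leI le_add_diff_inverse power_Suc power_add mult.assoc mult.commute)
  then have eq: "i + a * b ^ m = i + b ^ l * (b * (a * b ^ (m - Suc l)))"
    by (simp add: ac_simps)
  have "(i + a * b ^ m) div b ^ l = b * (a * b ^ (m - Suc l)) + i div b ^ l"
    unfolding eq using b0 by simp
  then show "ndigit b (i + a * b ^ m) l = ndigit b i l"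
    by (simp add: ndigit_def)
qed

lemma suminf_ndigit_mult:
  assumes "b \<ge> 2" "k \<le> N"
  shows "(\<Sum>l. ndigit b k l * g l) = (\<Sum>l<N. ndigit b k l * (g l :: nat))"
  using assms by (intro suminf_finite) (auto simp: ndigit_eq_0)

text \<open>Lets the pairing see the digits prescribed by \<open>nplus\<close> and
  \<open>nneg\<close> without evaluating the integers that they define.\<close>

lemma suminf_digits:
  assumes c: "\<And>l. c l < b" and z: "\<And>l. l \<ge> N \<Longrightarrow> c l = 0"
  shows "(\<Sum>l. ndigit b (\<Sum>l. c l * b ^ l) l * g l) = (\<Sum>l<N. c l * (g l :: nat))"
proof -
  have "(\<Sum>l. c l * b ^ l) = (\<Sum>l<N. c l * b ^ l)"
    using z by (intro suminf_finite) auto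
  then show ?thesis
    using ndigit_sum[of c b N, OF c] by (subst suminf_finite[of "{..<N}"]) auto
qed

text \<open>Termwise comparison with the geometric series of constant digit \<open>b - 1\<close>,
  whose sum is 1; a smaller digit makes the inequality strict. The condition on the digits is
  inherited by every tail, which is how the lemma is applied below.\<close>

lemma digit_tail_less_1:
  assumes b: "b \<ge> 2" and c: "\<And>l. c l < b" and inf: "infinite {l. c l \<noteq> b - 1}"
  shows "summable (\<lambda>l. real (c l) / real b ^ Suc l)"
    and "(\<Sum>l. real (c l) / real b ^ Suc l) < 1"
proof -
  have b1: "real b > 1" using b by simp
  let ?g = "\<lambda>l. (real b - 1) / real b ^ Suc l"
  have "(\<lambda>l. (1 / real b) ^ l * ((real b - 1) / real b)) sums (1 / (1 - 1 / real b) * ((real b - 1) / real b))"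
    using b1 by (intro sums_mult2 geometric_sums) auto
  then have g: "?g sums 1"
    using b1 by (simp add: power_one_over field_simps)
  have le: "real (c l) / real b ^ Suc l \<le> ?g l" for l
  proof -
    have "real (c l) \<le> real b - 1" using c[of l] by linarith
    then show ?thesis by (intro divide_right_mono) auto
  qed
  show sm: "summable (\<lambda>l. real (c l) / real b ^ Suc l)"
    by (rule summable_comparison_test[OF _ sums_summable[OF g]]) (use le in auto)
  obtain i where i: "c i \<noteq> b - 1"
    using inf by (metis (mono_tags, lifting) Collect_empty_eq finite.emptyI)
  have "real (c i) < real b - 1" using i c[of i] by linarith
  then have lt: "real (c i) / real b ^ Suc i < ?g i"
    using b1 by (intro divide_strict_right_mono) auto
  have "0 < (\<Sum>l. ?g l - real (c l) / real b ^ Suc l)"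
    using le lt by (intro suminf_pos2[of _ i] summable_diff sm sums_summable[OF g]) auto
  also have "\<dots> = 1 - (\<Sum>l. real (c l) / real b ^ Suc l)"
    using suminf_diff[OF sums_summable[OF g] sm] sums_unique[OF g] by simp
  finally show "(\<Sum>l. real (c l) / real b ^ Suc l) < 1" by simp
qed

text \<open>Uniqueness of proper expansions: multiplying by \<open>real b ^ n\<close> separates an
  integer formed by the first \<open>n\<close> digits from a tail in [0,1), so the floor is that
  integer.\<close>

lemma rdigit_suminf:
  assumes b: "b \<ge> 2" and c: "\<And>l. c l < b" and inf: "infinite {l. c l \<noteq> b - 1}"
  shows "rdigit b (\<Sum>l. real (c l) / real b ^ Suc l) (Suc n) = c n"
proof -
  have b0: "real b > 0" using b by simp
  define x where "x = (\<Sum>l. real (c l) / real b ^ Suc l)"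
  \<comment> \<open>The first \<open>n\<close> digits read as an integer, most significant first.
    Passing to \<open>Suc n\<close> is a Horner step, so reduction modulo \<open>b\<close> returns
    \<open>c n\<close>.\<close>
  define A where "A n = (\<Sum>l<n. c l * b ^ (n - Suc l))" for n
  have "\<lfloor>x * real b ^ n\<rfloor> = int (A n)" for n
  proof -
    \<comment> \<open>The digits after position \<open>n\<close>, rescaled to be the fractional part
      of \<open>x * real b ^ n\<close>.\<close>
    define t where "t = (\<Sum>l. real (c (l + n)) / real b ^ Suc l)"
    have inf': "infinite {l. c (l + n) \<noteq> b - 1}"
    proof
      assume "finite {l. c (l + n) \<noteq> b - 1}"
      then have "finite ((\<lambda>l. l + n) ` {l. c (l + n) \<noteq> b - 1} \<union> {..<n})" by blast
      moreover have "{l. c l \<noteq> b - 1} \<subseteq> (\<lambda>l. l + n) ` {l. c (l + n) \<noteq> b - 1} \<union> {..<n}"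
      proof
        fix l assume l: "l \<in> {l. c l \<noteq> b - 1}"
        show "l \<in> (\<lambda>l. l + n) ` {l. c (l + n) \<noteq> b - 1} \<union> {..<n}"
        proof (cases "l < n")
          case False
          then show ?thesis using l by (intro UnI1 image_eqI[of _ _ "l - n"]) auto
        qed auto
      qed
      ultimately show False using inf finite_subset by blast
    qed
    have t: "summable (\<lambda>l. real (c (l + n)) / real b ^ Suc l)" "t < 1"
      unfolding t_def using digit_tail_less_1[OF b c inf'] by auto
    have t0: "0 \<le> t" unfolding t_def using t(1) by (intro suminf_nonneg) auto
    have "x = (\<Sum>l. real (c (l + n)) / real b ^ Suc (l + n)) + (\<Sum>l<n. real (c l) / real b ^ Suc l)"
      unfolding x_def by (rule suminf_split_initial_segment[OF digit_tail_less_1(1)[OF b c inf]])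
    moreover have "(\<Sum>l. real (c (l + n)) / real b ^ Suc (l + n)) = t / real b ^ n"
      unfolding t_def using suminf_divide[OF t(1), of "real b ^ n"] by (simp add: power_add field_simps)
    ultimately have "x * real b ^ n = t + (\<Sum>l<n. real (c l) / real b ^ Suc l) * real b ^ n"
      using b0 by (simp add: distrib_right)
    also have "(\<Sum>l<n. real (c l) / real b ^ Suc l) * real b ^ n = real (A n)"
      unfolding A_def of_nat_sum sum_distrib_right
    proof (intro sum.cong refl)
      fix l assume "l \<in> {..<n}"
      then have "real b ^ n = real b ^ Suc l * real b ^ (n - Suc l)"
        by (metis Suc_leI lessThan_iff le_add_diff_inverse power_add)
      then show "real (c l) / real b ^ Suc l * real b ^ n = real (c l * b ^ (n - Suc l))"
        using b0 by simp
    qed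
    finally show ?thesis using t t0 by (simp add: floor_eq_iff)
  qed
  moreover have "A (Suc n) = b * A n + c n"
  proof -
    have "(\<Sum>l<n. c l * b ^ (n - l)) = b * A n"
      unfolding A_def sum_distrib_left
    proof (intro sum.cong refl)
      fix l assume "l \<in> {..<n}"
      then have "n - l = Suc (n - Suc l)" by auto
      then show "c l * b ^ (n - l) = b * (c l * b ^ (n - Suc l))" by simp
    qed
    then show ?thesis by (simp add: A_def)
  qed
  ultimately show ?thesis
    unfolding rdigit_def x_def[symmetric] using c[of n] by (simp del: power_Suc of_nat_add of_nat_mult)
qed

text \<open>The condition \<open>ok\<close> says that the digitwise sums form a proper expansion.
  Their series is therefore below 1, \<open>frac\<close> leaves it unchanged, and its digits can be
  read back.\<close>

lemma rdigit_dplus: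
  assumes b: "b \<ge> 2" and ok: "ok b x t"
  shows "rdigit b (dplus b x t $ j) (Suc l)
    = (rdigit b (x $ j) (Suc l) + rdigit b (t $ j) (Suc l)) mod b"
proof -
  define c where "c l = (rdigit b (x $ j) (Suc l) + rdigit b (t $ j) (Suc l)) mod b" for l
  have c: "c l < b" for l using b by (simp add: c_def)
  have "{l. l \<ge> 1 \<and> (rdigit b (x $ j) l + rdigit b (t $ j) l) mod b \<noteq> b - 1}
      \<subseteq> Suc ` {l. c l \<noteq> b - 1}"
  proof
    fix l assume "l \<in> {l. l \<ge> 1 \<and> (rdigit b (x $ j) l + rdigit b (t $ j) l) mod b \<noteq> b - 1}"
    then show "l \<in> Suc ` {l. c l \<noteq> b - 1}"
      by (intro image_eqI[of _ _ "l - 1"]) (auto simp: c_def)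
  qed
  then have inf: "infinite {l. c l \<noteq> b - 1}"
    using ok unfolding ok_def by (meson finite_imageI finite_subset)
  note s = digit_tail_less_1[OF b c inf]
  have "0 \<le> (\<Sum>l. real (c l) / real b ^ Suc l)"
    using s(1) by (intro suminf_nonneg) auto
  then have "dplus b x t $ j = (\<Sum>l. real (c l) / real b ^ Suc l)"
    unfolding dplus_def vec_lambda_beta unfolding c_def[symmetric] using s(2) by (simp add: frac_eq del: power_Suc)
  then show ?thesis using rdigit_suminf[OF b c inf] by (simp add: c_def)
qed

section \<open>The pairing\<close>

lemma mod_sum_cong:
  fixes f :: "'a \<Rightarrow> nat"
  assumes "\<And>x. x \<in> A \<Longrightarrow> f x mod b = g x mod b"
  shows "sum f A mod b = sum g A mod b"
proof -
  have "(\<Sum>x\<in>A. f x mod b) = (\<Sum>x\<in>A. g x mod b)"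
    using assms by (intro sum.cong) auto
  then show ?thesis by (metis mod_sum_eq)
qed

lemma pairing_mod [simp]: "pairing b k x mod b = pairing b k x"
  by (simp add: pairing_def)

lemma pairing_0_left [simp]: "pairing b 0 x = 0"
  by (simp add: pairing_def ndigit_def)

lemma pairing_0_right [simp]: "pairing b k 0 = 0"
  by (simp add: pairing_def rdigit_def)

lemma pairing_dplus:
  assumes b: "b \<ge> 2" and ok: "ok b x t"
  shows "pairing b k (dplus b x t) = (pairing b k x + pairing b k t) mod b"
proof -
  have "(\<Sum>l. ndigit b (k $ j) l * rdigit b (dplus b x t $ j) (Suc l)) mod b
      = ((\<Sum>l. ndigit b (k $ j) l * rdigit b (x $ j) (Suc l))
         + (\<Sum>l. ndigit b (k $ j) l * rdigit b (t $ j) (Suc l))) mod b" for j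
    unfolding suminf_ndigit_mult[OF b order_refl] sum.distrib[symmetric] rdigit_dplus[OF b ok]
    by (intro mod_sum_cong) (simp add: mod_mult_right_eq distrib_left[symmetric])
  then show ?thesis
    unfolding pairing_def mod_add_eq sum.distrib[symmetric] by (intro mod_sum_cong)
qed

lemma pairing_nplus:
  assumes b: "b \<ge> 2"
  shows "pairing b (nplus b k k') x = (pairing b k x + pairing b k' x) mod b"
proof -
  have "(\<Sum>l. ndigit b (nplus b k k' $ j) l * rdigit b (x $ j) (Suc l)) mod b
      = ((\<Sum>l. ndigit b (k $ j) l * rdigit b (x $ j) (Suc l))
         + (\<Sum>l. ndigit b (k' $ j) l * rdigit b (x $ j) (Suc l))) mod b" for j
  proof -
    define N where "N = max (k $ j) (k' $ j)"
    have N: "k $ j \<le> N" "k' $ j \<le> N" by (auto simp: N_def)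
    have "(\<Sum>l. ndigit b (nplus b k k' $ j) l * rdigit b (x $ j) (Suc l))
        = (\<Sum>l<N. ((ndigit b (k $ j) l + ndigit b (k' $ j) l) mod b) * rdigit b (x $ j) (Suc l))"
      unfolding nplus_def vec_lambda_beta
      by (rule suminf_digits) (use b N in \<open>auto simp: ndigit_eq_0\<close>)
    then show ?thesis
      unfolding suminf_ndigit_mult[OF b N(1)] suminf_ndigit_mult[OF b N(2)] sum.distrib[symmetric]
      by (auto intro!: mod_sum_cong simp: mod_mult_left_eq distrib_right[symmetric])
  qed
  then show ?thesis
    unfolding pairing_def mod_add_eq sum.distrib[symmetric] by (intro mod_sum_cong)
qed

text \<open>Stated additively because subtraction of naturals is truncated. Each digit and its
  negative contribute a multiple of \<open>b\<close>.\<close>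

lemma pairing_nneg:
  assumes b: "b \<ge> 2"
  shows "(pairing b (nneg b k) x + pairing b k x) mod b = 0"
proof -
  have "((\<Sum>l. ndigit b (nneg b k $ j) l * rdigit b (x $ j) (Suc l))
      + (\<Sum>l. ndigit b (k $ j) l * rdigit b (x $ j) (Suc l))) mod b = 0 mod b" for j
  proof -
    have "(\<Sum>l. ndigit b (nneg b k $ j) l * rdigit b (x $ j) (Suc l))
        = (\<Sum>l<k $ j. ((b - ndigit b (k $ j) l) mod b) * rdigit b (x $ j) (Suc l))"
      unfolding nneg_def vec_lambda_beta
      by (rule suminf_digits) (use b in \<open>auto simp: ndigit_eq_0\<close>)
    moreover have "((b - ndigit b (k $ j) l) mod b * r + ndigit b (k $ j) l * r) mod b = 0" for l r
    proof -
      have "((b - ndigit b (k $ j) l) mod b * r + ndigit b (k $ j) l * r) mod b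
          = ((b - ndigit b (k $ j) l) * r + ndigit b (k $ j) l * r) mod b"
        by (metis mod_add_left_eq mod_mult_left_eq)
      \<comment> \<open>Digits lie below \<open>b\<close>, so the truncated difference is a true
        one.\<close>
      also have "\<dots> = (b * r) mod b"
        using ndigit_less[of b "k $ j" l] b by (simp add: distrib_right[symmetric])
      finally show ?thesis by simp
    qed
    ultimately show ?thesis
      using mod_sum_cong[where A = "{..<k $ j}" and g = "\<lambda>_. 0"]
      unfolding suminf_ndigit_mult[OF b order_refl] by (simp add: sum.distrib[symmetric])
  qed
  then have "(\<Sum>j\<in>UNIV. (\<Sum>l. ndigit b (nneg b k $ j) l * rdigit b (x $ j) (Suc l))
      + (\<Sum>l. ndigit b (k $ j) l * rdigit b (x $ j) (Suc l))) mod b = (\<Sum>j\<in>(UNIV::'a set). 0) mod b"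
    by (intro mod_sum_cong)
  then show ?thesis
    unfolding pairing_def mod_add_eq sum.distrib[symmetric] by simp
qed

text \<open>Turns conditions on a digitwise difference, as in the definition of the wavenumber map,
  into relations between two pairings.\<close>

lemma pairing_nminus:
  assumes b: "b \<ge> 2"
  shows "(pairing b (nminus b k k') x + pairing b k' x) mod b = pairing b k x"
proof -
  have "(pairing b (nminus b k k') x + pairing b k' x) mod b
      = (pairing b k x + (pairing b (nneg b k') x + pairing b k' x)) mod b"
    unfolding nminus_def pairing_nplus[OF b] by (simp add: mod_add_left_eq add.assoc)
  also have "\<dots> = pairing b k x"
    using mod_add_right_eq[of "pairing b k x" "pairing b (nneg b k') x + pairing b k' x" b]
    by (simp add: pairing_nneg[OF b])
  finally show ?thesis .
qed

section \<open>Digital sequences\<close>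

lemma digital_sequence_expansion:
  assumes "digital_sequence b z" "i < b ^ n"
  shows "z i = dsum b (\<lambda>l. dscale b (ndigit b i l) (z (b ^ l))) n"
proof -
  have "\<forall>n. \<forall>i<b ^ n. z i = dsum b (\<lambda>l. dscale b (ndigit b i l) (z (b ^ l))) n"
    using assms(1) unfolding digital_sequence_def by (elim conjE)
  then show ?thesis by (elim allE impE) (rule assms(2))
qed

lemma digital_sequence_closed:
  assumes "digital_sequence b z"
  shows "\<forall>x\<in>range z. \<forall>t\<in>range z. dplus b x t \<in> range z \<and> ok b x t"
  using assms unfolding digital_sequence_def by (elim conjE)

lemma digital_sequence_0:
  assumes "digital_sequence b z"
  shows "z 0 = 0"
  using digital_sequence_expansion[OF assms, of 0 0] by simp

text \<open>Both claims need the same induction: the pairing is additive only under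
  \<open>ok\<close>, which is available because the multiple built so far is again a point of the
  sequence.\<close>

lemma dscale_digital_sequence:
  assumes b: "b \<ge> 2" and ds: "digital_sequence b z"
  shows "dscale b a (z i) \<in> range z"
    and "pairing b k (dscale b a (z i)) = a * pairing b k (z i) mod b"
proof -
  note cl = digital_sequence_closed[OF ds]
  have "dscale b a (z i) \<in> range z \<and> pairing b k (dscale b a (z i)) = a * pairing b k (z i) mod b"
  proof (induction a)
    case 0
    then show ?case by (simp add: dscale_def rangeI[of z 0, unfolded digital_sequence_0[OF ds]])
  next
    case (Suc a)
    have st: "dscale b (Suc a) (z i) = dplus b (z i) (dscale b a (z i))" by (simp add: dscale_def)
    have k: "ok b (z i) (dscale b a (z i))" using Suc cl by blast
    show ?case unfolding st using Suc cl
      by (auto simp: pairing_dplus[OF b k] mod_add_right_eq)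
  qed
  then show "dscale b a (z i) \<in> range z"
    and "pairing b k (dscale b a (z i)) = a * pairing b k (z i) mod b" by auto
qed

lemma dsum_cong: "(\<And>l. l < n \<Longrightarrow> v l = w l) \<Longrightarrow> dsum b v n = dsum b w n"
  by (induction n) auto

text \<open>The digits of \<open>i + a * b ^ m\<close> are those of \<open>i\<close> below position
  \<open>m\<close>, with \<open>a\<close> at position \<open>m\<close>. Hence the new point is
  \<open>z i\<close> plus a multiple of one new generator, and the pairing is additive in the
  point.\<close>

lemma pairing_digital_sequence_step:
  assumes b: "b \<ge> 2" and ds: "digital_sequence b z" and i: "i < b ^ m" and a: "a < b"
  shows "pairing b k (z (i + a * b ^ m)) = (pairing b k (z i) + a * pairing b k (z (b ^ m))) mod b"
proof -
  note cl = digital_sequence_closed[OF ds] and zi = digital_sequence_expansion[OF ds]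
  let ?i = "i + a * b ^ m"
  have "?i < b ^ m + a * b ^ m" using i by simp
  also have "\<dots> \<le> b ^ Suc m" using mult_le_mono1[of "Suc a" b "b ^ m"] a by simp
  finally have "z ?i = dplus b (dsum b (\<lambda>l. dscale b (ndigit b ?i l) (z (b ^ l))) m) (dscale b a (z (b ^ m)))"
    using zi[of ?i "Suc m"] ndigit_add_power(2)[OF i a] by simp
  also have "dsum b (\<lambda>l. dscale b (ndigit b ?i l) (z (b ^ l))) m = z i"
    unfolding zi[OF i] by (rule dsum_cong) (simp add: ndigit_add_power(1)[OF i a])
  finally have "z ?i = dplus b (z i) (dscale b a (z (b ^ m)))" .
  moreover have "ok b (z i) (dscale b a (z (b ^ m)))"
    using cl dscale_digital_sequence(1)[OF b ds] by blast
  ultimately show ?thesis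
    by (simp add: pairing_dplus[OF b] dscale_digital_sequence(2)[OF b ds] mod_add_right_eq)
qed

lemma block_decomposition:
  fixes n b m :: nat
  assumes "n < b ^ Suc m"
  obtains i a where "n = i + a * b ^ m" "i < b ^ m" "a < b"
proof
  have "0 < b ^ m" using assms by (cases "b = 0") auto
  then show "n mod b ^ m < b ^ m" by simp
  show "n = n mod b ^ m + (n div b ^ m) * b ^ m"
    by (rule mod_div_mult_eq[symmetric])
  show "n div b ^ m < b" using assms by (simp add: less_mult_imp_div_less)
qed

section \<open>The wavenumber map\<close>

text \<open>Two wavenumbers agree modulo the dual net at level \<open>m\<close> iff they have the same pairings with
  the generators below level \<open>m\<close>; this form avoids digitwise subtraction.\<close>

definition net_equiv :: "nat \<Rightarrow> (nat \<Rightarrow> real ^ 'd) \<Rightarrow> nat \<Rightarrow> nat ^ 'd \<Rightarrow> nat ^ 'd \<Rightarrow> bool" where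
  "net_equiv b z m k k' \<longleftrightarrow> (\<forall>l<m. pairing b k (z (b ^ l)) = pairing b k' (z (b ^ l)))"

text \<open>Adjoining \<open>a = 0\<close>, where the wavenumber is \<open>kt \<kappa>\<close>
  itself, extends the permutation of the nonzero residues to all residues. The index digit
  \<open>a\<close> then corresponds bijectively to the pairing with the new generator.\<close>

lemma wavenumber_map_step:
  assumes b: "b \<ge> 2" and wm: "wavenumber_map b z kt" and \<kappa>: "\<kappa> < b ^ m"
  shows "\<exists>\<sigma>. bij_betw \<sigma> {..<b} {..<b} \<and> (\<forall>a<b. net_equiv b z m (kt (\<kappa> + a * b ^ m)) (kt \<kappa>) \<and>
    pairing b (kt (\<kappa> + a * b ^ m)) (z (b ^ m)) = (\<sigma> a + pairing b (kt \<kappa>) (z (b ^ m))) mod b)"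
proof -
  obtain \<sigma> where bij: "bij_betw \<sigma> {1..<b} {1..<b}" and \<sigma>: "\<And>a. a \<in> {1..<b} \<Longrightarrow>
      nminus b (kt (\<kappa> + a * b ^ m)) (kt \<kappa>) \<in> dual_net b z m \<and>
      pairing b (nminus b (kt (\<kappa> + a * b ^ m)) (kt \<kappa>)) (z (b ^ m)) = \<sigma> a"
    using wm \<kappa> unfolding wavenumber_map_def by blast
  define \<tau> where "\<tau> = \<sigma>(0 := 0)"
  have "bij_betw \<tau> {1..<b} {1..<b} \<longleftrightarrow> bij_betw \<sigma> {1..<b} {1..<b}"
    by (rule bij_betw_cong) (simp add: \<tau>_def)
  with bij have "bij_betw \<tau> ({1..<b} \<union> {0}) ({1..<b} \<union> {0})"
    by (intro bij_betw_combine) (auto simp: \<tau>_def)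
  moreover have "{1..<b} \<union> {0} = {..<b}" using b by auto
  ultimately have "bij_betw \<tau> {..<b} {..<b}" by simp
  moreover have "net_equiv b z m (kt (\<kappa> + a * b ^ m)) (kt \<kappa>)" if "a < b" for a
  proof (cases "a = 0")
    case False
    have "pairing b (nminus b (kt (\<kappa> + a * b ^ m)) (kt \<kappa>)) (z (b ^ l)) = 0" if "l < m" for l
      using \<sigma>[of a] False \<open>a < b\<close> that b by (simp add: dual_net_def)
    then show ?thesis
      using pairing_nminus[OF b, of "kt (\<kappa> + a * b ^ m)" "kt \<kappa>"]
      unfolding net_equiv_def by (metis add_0 pairing_mod)
  qed (simp add: net_equiv_def)
  moreover have "pairing b (kt (\<kappa> + a * b ^ m)) (z (b ^ m))
      = (\<tau> a + pairing b (kt \<kappa>) (z (b ^ m))) mod b" if "a < b" for a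
    using \<sigma>[of a] that pairing_nminus[OF b, of "kt (\<kappa> + a * b ^ m)" "kt \<kappa>" "z (b ^ m)"]
    by (cases "a = 0") (auto simp: \<tau>_def)
  ultimately show ?thesis by blast
qed

text \<open>Each digit of \<open>n\<close> at a position \<open>m\<close> or higher can be stripped,
  from the top, without changing the pairings with the generators below level
  \<open>m\<close>.\<close>

lemma net_equiv_mod:
  assumes b: "b \<ge> 2" and wm: "wavenumber_map b z kt"
  shows "net_equiv b z m (kt n) (kt (n mod b ^ m))"
proof -
  have "n < b ^ (m + M) \<Longrightarrow> net_equiv b z m (kt n) (kt (n mod b ^ m))" for M
  proof (induction M arbitrary: n)
    case 0
    then show ?case by (simp add: net_equiv_def)
  next
    case (Suc M)
    obtain i a where n: "n = i + a * b ^ (m + M)" and i: "i < b ^ (m + M)" and a: "a < b"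
      using Suc.prems block_decomposition[of n b "m + M"] by auto
    have "net_equiv b z (m + M) (kt n) (kt i)"
      using wavenumber_map_step[OF b wm i] a n by blast
    moreover have "n mod b ^ m = i mod b ^ m" unfolding n by (simp add: power_add mult.left_commute[of a])
    ultimately show ?case using Suc.IH[OF i] by (simp add: net_equiv_def)
  qed
  \<comment> \<open>A crude bound for the number of digits to strip is \<open>n\<close>
    itself.\<close>
  moreover have "n < b ^ (m + n)"
  proof -
    have "n < 2 ^ n" by (rule less_exp)
    also have "\<dots> \<le> b ^ n" using b by (intro power_mono) auto
    also have "\<dots> \<le> b ^ (m + n)" using b by (intro power_increasing) auto
    finally show ?thesis .
  qed
  ultimately show ?thesis by blast
qed

text \<open>The index digits are recovered one level at a time: the lower ones by induction, the top
  one because the permutation of residues is injective.\<close>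

lemma net_equiv_inj:
  assumes b: "b \<ge> 2" and wm: "wavenumber_map b z kt"
  shows "\<lbrakk>i < b ^ m; i' < b ^ m; net_equiv b z m (kt i) (kt i')\<rbrakk> \<Longrightarrow> i = i'"
proof (induction m arbitrary: i i')
  case (Suc m)
  obtain j a where i: "i = j + a * b ^ m" and j: "j < b ^ m" and a: "a < b"
    using block_decomposition[OF Suc.prems(1)] by blast
  obtain j' a' where i': "i' = j' + a' * b ^ m" and j': "j' < b ^ m" and a': "a' < b"
    using block_decomposition[OF Suc.prems(2)] by blast
  have "net_equiv b z m (kt i) (kt j)" "net_equiv b z m (kt i') (kt j')"
    using wavenumber_map_step[OF b wm j] wavenumber_map_step[OF b wm j'] a a' i i' by blast+
  then have "j = j'"
    using Suc.IH[OF j j'] Suc.prems(3) by (simp add: net_equiv_def)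
  obtain \<sigma> where bij: "bij_betw \<sigma> {..<b} {..<b}" and \<sigma>: "\<forall>a<b. pairing b (kt (j + a * b ^ m)) (z (b ^ m))
      = (\<sigma> a + pairing b (kt j) (z (b ^ m))) mod b"
    using wavenumber_map_step[OF b wm j] by blast
  have "(\<sigma> a + pairing b (kt j) (z (b ^ m))) mod b = (\<sigma> a' + pairing b (kt j) (z (b ^ m))) mod b"
    using \<sigma>[rule_format, OF a] \<sigma>[rule_format, OF a'] Suc.prems(3) i i' \<open>j = j'\<close> by (simp add: net_equiv_def)
  \<comment> \<open>Since the lower parts coincide, the same pairing is added on both sides and
    cancels.\<close>
  then have "[\<sigma> a = \<sigma> a'] (mod b)"
    by (simp add: cong_add_rcancel_nat flip: cong_def)
  moreover have "\<sigma> a < b" "\<sigma> a' < b" using bij a a' by (auto simp: bij_betw_def)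
  ultimately have "\<sigma> a = \<sigma> a'" by (simp add: cong_def)
  then have "a = a'" using bij a a' by (auto simp: bij_betw_def inj_on_def)
  then show ?case using i i' \<open>j = j'\<close> by simp
qed simp

text \<open>Identifies the aliases of \<open>kt \<kappa>\<close> with a residue class of indices,
  the form in which they enter \<open>S_hat\<close>.\<close>

lemma net_equiv_iff:
  assumes b: "b \<ge> 2" and wm: "wavenumber_map b z kt" and "\<kappa> < b ^ m"
  shows "net_equiv b z m (kt n) (kt \<kappa>) \<longleftrightarrow> n mod b ^ m = \<kappa>"
proof
  assume "net_equiv b z m (kt n) (kt \<kappa>)"
  then have "net_equiv b z m (kt (n mod b ^ m)) (kt \<kappa>)"
    using net_equiv_mod[OF b wm, of m n] by (simp add: net_equiv_def)
  then show "n mod b ^ m = \<kappa>"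
    using net_equiv_inj[OF b wm _ assms(3)] b by simp
next
  assume "n mod b ^ m = \<kappa>"
  then show "net_equiv b z m (kt n) (kt \<kappa>)" using net_equiv_mod[OF b wm, of m n] by simp
qed

text \<open>Injectivity follows by taking a level that exceeds both indices. Bijectivity allows the
  Walsh series to be summed over indices instead of wavenumbers.\<close>

lemma wavenumber_map_bij:
  assumes b: "b \<ge> 2" and wm: "wavenumber_map b z kt"
  shows "bij kt"
proof -
  have "n = n'" if "kt n = kt n'" for n n'
  proof -
    have "k < b ^ k" for k
      using less_exp[of k] power_mono[of 2 b k] b by linarith
    then have "n < b ^ (n + n')" "n' < b ^ (n + n')"
      using b by (meson le_add1 le_add2 less_le_trans one_le_numeral order_trans power_increasing)+
    then show ?thesis using net_equiv_inj[OF b wm] that by (simp add: net_equiv_def)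
  qed
  moreover have "surj kt" using wm unfolding wavenumber_map_def by blast
  ultimately show ?thesis by (simp add: bij_def inj_def)
qed

section \<open>Characters and aliasing\<close>

text \<open>The argument is an integer so that differences of pairings can be formed without
  truncation.\<close>

definition unit_char :: "nat \<Rightarrow> int \<Rightarrow> complex" where
  "unit_char b j = cis (2 * pi * of_int j / of_nat b)"

lemma unit_char_0 [simp]: "unit_char b 0 = 1"
  by (simp add: unit_char_def)

lemma norm_unit_char [simp]: "cmod (unit_char b j) = 1"
  by (simp add: unit_char_def)

lemma unit_char_add: "unit_char b (i + j) = unit_char b i * unit_char b j"
  by (simp add: unit_char_def cis_mult add_divide_distrib distrib_left)

lemma unit_char_of_nat_mult: "unit_char b (int a * j) = unit_char b j ^ a"
  by (simp add: unit_char_def Complex.DeMoivre mult.left_commute)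

lemma unit_char_eq_1_iff:
  assumes "b > 0"
  shows "unit_char b j = 1 \<longleftrightarrow> int b dvd j"
proof -
  have "unit_char b j = 1 \<longleftrightarrow> (\<exists>n::int. 2 * pi * of_int j / of_nat b = of_int n * 2 * pi)"
    unfolding unit_char_def cis_conv_exp exp_eq_1 by (simp add: mult_ac)
  also have "\<dots> \<longleftrightarrow> (\<exists>n::int. real_of_int j = of_int (int b * n))"
    using assms by (simp add: field_simps)
  also have "\<dots> \<longleftrightarrow> int b dvd j" unfolding of_int_eq_iff dvd_def ..
  finally show ?thesis .
qed

lemma unit_char_cong:
  assumes "b > 0" "[i = j] (mod int b)"
  shows "unit_char b i = unit_char b j"
proof -
  have "int b dvd i - j" using assms(2) by (simp add: cong_iff_dvd_diff)
  then have "unit_char b (i - j + j) = unit_char b j"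
    unfolding unit_char_add using unit_char_eq_1_iff[OF assms(1)] by simp
  then show ?thesis by simp
qed

lemma walsh_eq_unit_char: "walsh b k x = unit_char b (int (pairing b k x))"
  by (simp add: walsh_def unit_char_def cis_conv_exp mult_ac)

lemma exp_eq_unit_char:
  "exp (- 2 * of_real pi * \<i> * of_nat n / of_nat b) = unit_char b (- int n)"
  by (simp add: unit_char_def cis_conv_exp mult_ac)

text \<open>A geometric sum over powers of a \<open>b\<close>-th root of unity, which vanishes
  unless the root is 1.\<close>

lemma sum_unit_char:
  assumes "b > 0"
  shows "(\<Sum>a<b. unit_char b (int a * D)) = (if int b dvd D then of_nat b else 0)"
proof (cases "int b dvd D")
  case False
  then have "unit_char b D \<noteq> 1" using unit_char_eq_1_iff[OF assms] by simp
  moreover have "unit_char b D ^ b = 1"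
    using unit_char_eq_1_iff[OF assms, of "int b * D"] by (simp add: unit_char_of_nat_mult)
  ultimately show ?thesis using False by (simp add: unit_char_of_nat_mult geometric_sum)
next
  case True
  then have "unit_char b D = 1" using unit_char_eq_1_iff[OF assms] by simp
  then show ?thesis using True by (simp add: unit_char_of_nat_mult)
qed

lemma sum_block_decomposition:
  "(\<Sum>i<b ^ Suc m. g i) = (\<Sum>a<b. \<Sum>i<b ^ m. g (i + a * b ^ m))"
  for g :: "nat \<Rightarrow> 'a::comm_monoid_add"
proof -
  have "sum g {a * b ^ m..<a * b ^ m + b ^ m} = (\<Sum>i<b ^ m. g (i + a * b ^ m))" for a
    using sum.shift_bounds_nat_ivl[of g 0 "a * b ^ m" "b ^ m"] by (simp add: add.commute lessThan_atLeast0)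
  then show ?thesis using sum.nat_group[of g "b ^ m" b] by simp
qed

text \<open>Level \<open>Suc m\<close> consists of \<open>b\<close> translates of level
  \<open>m\<close> by multiples of the new generator. The sum factors accordingly, and the new
  factor is \<open>b\<close> or 0 according to whether the pairings with that generator
  agree.\<close>

lemma walsh_orthogonality:
  assumes b: "b \<ge> 2" and ds: "digital_sequence b z"
  shows "(\<Sum>i<b ^ m. unit_char b (int (pairing b k (z i)) - int (pairing b k' (z i))))
    = (if net_equiv b z m k k' then of_nat (b ^ m) else 0)"
proof (induction m)
  case 0
  then show ?case by (simp add: net_equiv_def digital_sequence_0[OF ds])
next
  case (Suc m)
  define D where "D = int (pairing b k (z (b ^ m))) - int (pairing b k' (z (b ^ m)))"
  have b0: "b > 0" using b by simp
  have "unit_char b (int (pairing b k (z (i + a * b ^ m))) - int (pairing b k' (z (i + a * b ^ m))))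
      = unit_char b (int a * D) * unit_char b (int (pairing b k (z i)) - int (pairing b k' (z i)))"
    if "i < b ^ m" "a < b" for i a
    unfolding unit_char_add[symmetric] pairing_digital_sequence_step[OF b ds that]
    by (rule unit_char_cong[OF b0]) (simp add: D_def cong_def zmod_int mod_simps algebra_simps)
  then have "(\<Sum>i<b ^ Suc m. unit_char b (int (pairing b k (z i)) - int (pairing b k' (z i))))
      = (\<Sum>a<b. \<Sum>i<b ^ m. unit_char b (int a * D)
          * unit_char b (int (pairing b k (z i)) - int (pairing b k' (z i))))"
    unfolding sum_block_decomposition by (intro sum.cong) auto
  also have "\<dots> = (if int b dvd D then of_nat b else 0) * (if net_equiv b z m k k' then of_nat (b ^ m) else 0)"
    by (simp only: sum_distrib_left[symmetric] sum_distrib_right[symmetric] sum_unit_char[OF b0] Suc.IH)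
  \<comment> \<open>Pairings are already reduced modulo \<open>b\<close>, so congruence means
    equality.\<close>
  also have "int b dvd D \<longleftrightarrow> pairing b k (z (b ^ m)) = pairing b k' (z (b ^ m))"
  proof -
    have "int b dvd D \<longleftrightarrow> [pairing b k (z (b ^ m)) = pairing b k' (z (b ^ m))] (mod b)"
      by (simp add: D_def cong_iff_dvd_diff flip: cong_int_iff)
    then show ?thesis by (simp add: cong_def)
  qed
  finally show ?case by (auto simp: net_equiv_def less_Suc_eq)
qed

section \<open>Aliases in the discrete Walsh transform\<close>

lemma has_sum_sum:
  fixes f :: "'i \<Rightarrow> 'a \<Rightarrow> 'b::topological_comm_monoid_add"
  assumes "\<And>i. i \<in> I \<Longrightarrow> (f i has_sum s i) A"
  shows "((\<lambda>x. \<Sum>i\<in>I. f i x) has_sum (\<Sum>i\<in>I. s i)) A"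
  using assms by (induction I rule: infinite_finite_induct) (auto intro: has_sum_add)

text \<open>For complex terms \<open>has_sum\<close> entails absolute convergence, so the triangle
  inequality passes to the limit. The bound is in \<open>ennreal\<close> to match the sums in the
  cone conditions.\<close>

lemma norm_has_sum_le_suminf_ennreal:
  fixes h :: "nat \<Rightarrow> complex"
  assumes "(h has_sum s) UNIV"
  shows "ennreal (cmod s) \<le> (\<Sum>n. ennreal (cmod (h n)))"
proof -
  have "(\<lambda>n. cmod (h n)) summable_on UNIV"
    using assms summable_on_iff_abs_summable_on_complex summable_on_def by blast
  then have sm: "summable (\<lambda>n. cmod (h n))" by (rule summable_on_imp_summable)
  have "s = suminf h" using has_sum_imp_sums[OF assms] by (rule sums_unique)
  then have "cmod s \<le> (\<Sum>n. cmod (h n))" using summable_norm[OF sm] by simp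
  then show ?thesis by (simp add: suminf_ennreal2[OF _ sm] ennreal_leI)
qed

text \<open>The shift \<open>\<Delta>\<close> multiplies each alias by a factor of modulus 1, so it
  disappears once norms are taken.\<close>

lemma discrete_walsh_aliasing:
  fixes z :: "nat \<Rightarrow> real ^ 'd"
  assumes b: "b \<ge> 2" and ds: "digital_sequence b z" and ok: "\<And>i. ok b (z i) \<Delta>"
    and wm: "wavenumber_map b z kt"
    and series: "\<And>i. ((\<lambda>k. walsh_coeff b f k * walsh b k (dplus b (z i) \<Delta>))
            has_sum f (dplus b (z i) \<Delta>)) UNIV"
    and \<kappa>: "\<kappa> < b ^ m"
  shows "ennreal (cmod (discrete_walsh b z \<Delta> f m (kt \<kappa>) - walsh_coeff b f (kt \<kappa>)))
    \<le> (\<Sum>n. ennreal (cmod (walsh_coeff b f (kt (\<kappa> + Suc n * b ^ m)))))"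
proof -
  have b0: "b > 0" using b by simp
  define g where "g n = walsh_coeff b f (kt n)" for n
  \<comment> \<open>The contribution of index \<open>n\<close> after averaging over the net: only
    the residue class of \<open>\<kappa>\<close> survives, with a phase due to the shift.\<close>
  define h where "h n = (if n mod b ^ m = \<kappa> then
    g n * unit_char b (int (pairing b (kt n) \<Delta>) - int (pairing b (kt \<kappa>) \<Delta>)) else 0)" for n
  define x where "x i = dplus b (z i) \<Delta>" for i
  have "((\<lambda>n. g n * walsh b (kt n) (x i)) has_sum f (x i)) UNIV" for i
    using series[of i] has_sum_reindex_bij_betw[OF wavenumber_map_bij[OF b wm],
        of "\<lambda>k. walsh_coeff b f k * walsh b k (x i)"]
    by (simp add: g_def x_def)
  \<comment> \<open>The average involves finitely many points, so it may be taken term by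
    term.\<close>
  then have "((\<lambda>n. inverse (of_nat (b ^ m)) *
        (\<Sum>i<b ^ m. unit_char b (- int (pairing b (kt \<kappa>) (x i))) * (g n * walsh b (kt n) (x i))))
      has_sum (inverse (of_nat (b ^ m)) *
        (\<Sum>i<b ^ m. unit_char b (- int (pairing b (kt \<kappa>) (x i))) * f (x i)))) UNIV"
    by (intro has_sum_cmult_right has_sum_sum)
  also have "inverse (of_nat (b ^ m)) * (\<Sum>i<b ^ m. unit_char b (- int (pairing b (kt \<kappa>) (x i))) * f (x i))
      = discrete_walsh b z \<Delta> f m (kt \<kappa>)"
    unfolding discrete_walsh_def exp_eq_unit_char x_def by (simp add: divide_inverse mult.commute)
  also have "(\<lambda>n. inverse (of_nat (b ^ m)) *
        (\<Sum>i<b ^ m. unit_char b (- int (pairing b (kt \<kappa>) (x i))) * (g n * walsh b (kt n) (x i)))) = h"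
  proof
    fix n
    define e where "e = unit_char b (int (pairing b (kt n) \<Delta>) - int (pairing b (kt \<kappa>) \<Delta>))"
    have "unit_char b (- int (pairing b (kt \<kappa>) (x i))) * (g n * walsh b (kt n) (x i))
        = g n * e * unit_char b (int (pairing b (kt n) (z i)) - int (pairing b (kt \<kappa>) (z i)))" for i
    proof -
      have "unit_char b (- int (pairing b (kt \<kappa>) (x i)) + int (pairing b (kt n) (x i)))
          = unit_char b ((int (pairing b (kt n) \<Delta>) - int (pairing b (kt \<kappa>) \<Delta>))
              + (int (pairing b (kt n) (z i)) - int (pairing b (kt \<kappa>) (z i))))"
        unfolding x_def pairing_dplus[OF b ok]
        by (rule unit_char_cong[OF b0]) (simp add: cong_def zmod_int mod_simps algebra_simps)
      then show ?thesis
        unfolding walsh_eq_unit_char e_def unit_char_add by (simp add: ac_simps)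
    qed
    then have "(\<Sum>i<b ^ m. unit_char b (- int (pairing b (kt \<kappa>) (x i))) * (g n * walsh b (kt n) (x i)))
        = g n * e * (if n mod b ^ m = \<kappa> then of_nat (b ^ m) else 0)"
      by (simp only: sum_distrib_left[symmetric] walsh_orthogonality[OF b ds] net_equiv_iff[OF b wm \<kappa>])
    then show "inverse (of_nat (b ^ m)) *
        (\<Sum>i<b ^ m. unit_char b (- int (pairing b (kt \<kappa>) (x i))) * (g n * walsh b (kt n) (x i))) = h n"
      using b0 by (simp add: h_def e_def)
  qed
  finally have "(h has_sum discrete_walsh b z \<Delta> f m (kt \<kappa>)) UNIV" .
  \<comment> \<open>At \<open>\<kappa>\<close> the phase is 1, so removing this index subtracts
    exactly the true coefficient.\<close>
  moreover have "(h has_sum h \<kappa>) {\<kappa>}" by (simp add: has_sum_finiteI)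
  ultimately have "(h has_sum (discrete_walsh b z \<Delta> f m (kt \<kappa>) - h \<kappa>)) (UNIV - {\<kappa>})"
    by (rule has_sum_Diff) simp
  also have "h \<kappa> = walsh_coeff b f (kt \<kappa>)" using \<kappa> by (simp add: h_def g_def)
  also have "(h has_sum (discrete_walsh b z \<Delta> f m (kt \<kappa>) - walsh_coeff b f (kt \<kappa>))) (UNIV - {\<kappa>})
      \<longleftrightarrow> (h has_sum (discrete_walsh b z \<Delta> f m (kt \<kappa>) - walsh_coeff b f (kt \<kappa>)))
            (range (\<lambda>n. \<kappa> + Suc n * b ^ m))"
  proof (rule has_sum_cong_neutral)
    fix n assume n: "n \<in> (UNIV - {\<kappa>}) - range (\<lambda>n. \<kappa> + Suc n * b ^ m)"
    \<comment> \<open>Residue \<open>\<kappa>\<close> with quotient 0 would give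
      \<open>\<kappa>\<close> itself, and with positive quotient a member of the progression; both
      are excluded.\<close>
    have "n mod b ^ m \<noteq> \<kappa>"
    proof
      assume "n mod b ^ m = \<kappa>"
      then have eq: "n = \<kappa> + (n div b ^ m) * b ^ m"
        by (metis add.commute div_mult_mod_eq)
      then have "n div b ^ m \<noteq> 0" using n by auto
      then have "n = \<kappa> + Suc (n div b ^ m - 1) * b ^ m" using eq by simp
      then show False using n by blast
    qed
    then show "h n = 0" by (simp add: h_def)
  qed (use b0 in auto)
  also have "\<dots> \<longleftrightarrow> ((\<lambda>n. h (\<kappa> + Suc n * b ^ m)) has_sum
      (discrete_walsh b z \<Delta> f m (kt \<kappa>) - walsh_coeff b f (kt \<kappa>))) UNIV"
    using b0 by (subst has_sum_reindex) (auto simp: inj_def o_def)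
  finally have "ennreal (cmod (discrete_walsh b z \<Delta> f m (kt \<kappa>) - walsh_coeff b f (kt \<kappa>)))
      \<le> (\<Sum>n. ennreal (cmod (h (\<kappa> + Suc n * b ^ m))))"
    by (rule norm_has_sum_le_suminf_ennreal)
  moreover have "cmod (h (\<kappa> + Suc n * b ^ m)) = cmod (g (\<kappa> + Suc n * b ^ m))" for n
  proof -
    have "(\<kappa> + Suc n * b ^ m) mod b ^ m = \<kappa>" using \<kappa> by (subst mod_mult_self1) simp
    then show ?thesis unfolding h_def by (simp add: norm_mult del: mult_Suc)
  qed
  ultimately show ?thesis by (simp only: g_def)
qed

text \<open>The identification of \<open>f\<close> with its Walsh series at the sampled points is
  expressed by \<open>has_sum\<close>, that is, by unconditional summation over the
  wavenumbers.\<close>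

theorem mainTheorem2:
  fixes b :: nat
    and z :: "nat \<Rightarrow> real ^ 'd" and \<Delta> :: "real ^ 'd"
    and kt :: "nat \<Rightarrow> nat ^ 'd"
    and l_star l m :: nat
    and \<omega>hat \<omega>ring :: "nat \<Rightarrow> real"
    and f :: "real ^ 'd \<Rightarrow> complex"
  assumes "prime b"
    and "digital_sequence b z"
    and "\<Delta> \<in> half_open_cube"
    and "\<And>i. ok b (z i) \<Delta>"
    and "wavenumber_map b z kt"
    and "l_star \<ge> 1"
    and "\<And>r. \<omega>hat r \<ge> 0" and "\<And>r. \<omega>ring r \<ge> 0"
    and "\<omega>ring \<longlonglongrightarrow> 0"
    and "\<exists>r\<ge>1. \<omega>hat r * \<omega>ring r < 1"
    and "f \<in> integrand_cone b kt l_star \<omega>hat \<omega>ring"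
    and "\<And>i. ((\<lambda>k. walsh_coeff b f k * walsh b k (dplus b (z i) \<Delta>))
            has_sum f (dplus b (z i) \<Delta>)) UNIV"
    and "l_star \<le> l" and "l \<le> m"
    and "\<omega>hat (m - l) * \<omega>ring (m - l) < 1"
  shows "cmod ((LINT x|lebesgue_on half_open_cube. f x) - cubature b z \<Delta> f m)
    \<le> S_tilde b z \<Delta> kt f l m * \<omega>hat m * \<omega>ring (m - l)
       / (1 - \<omega>hat (m - l) * \<omega>ring (m - l))"
proof -
  have b: "b \<ge> 2" using assms(1) by (rule prime_ge_2_nat)
  \<comment> \<open>At level 0 the lower limit \<open>1 div b\<close> is 0, so \<open>S_hat\<close>
    with first level 0 sums exactly the aliases of the zero wavenumber.\<close>
  have block0: "{b ^ 0 div b..<b ^ 0} = {0}" using b by auto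
  have b0: "0 < b ^ m" using b by simp
  have kt0: "kt 0 = 0" using assms(5) by (simp add: wavenumber_map_def)
  have aliases: "ennreal (cmod (discrete_walsh b z \<Delta> f m (kt \<kappa>) - walsh_coeff b f (kt \<kappa>)))
    \<le> (\<Sum>n. ennreal (cmod (walsh_coeff b f (kt (\<kappa> + Suc n * b ^ m)))))" if "\<kappa> < b ^ m" for \<kappa>
    using discrete_walsh_aliasing[OF b assms(2) assms(4) assms(5) assms(12) that] .
  define \<alpha> \<beta> S T where "\<alpha> = \<omega>hat (m - l)" and "\<beta> = \<omega>ring (m - l)"
    and "S = S_sum b kt f l" and "T = S_tilde b z \<Delta> kt f l m"
  have nn: "\<alpha> \<ge> 0" "\<beta> \<ge> 0" "\<omega>hat m \<ge> 0" "S \<ge> 0" "T \<ge> 0"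
    using assms(7,8) by (auto simp: \<alpha>_def \<beta>_def S_def T_def S_sum_def S_tilde_def sum_nonneg)
  have check: "S_check b kt f m \<le> ennreal (\<beta> * S)"
    using assms(11,13,14) nn by (simp add: integrand_cone_def \<beta>_def S_def ennreal_mult)
  \<comment> \<open>Both cone conditions combined; used with \<open>l' = l\<close> to bound
    \<open>S\<close> and with \<open>l' = 0\<close> to bound the cubature error.\<close>
  have hat: "S_hat b kt f l' m \<le> ennreal (\<omega>hat (m - l') * (\<beta> * S))" if "l' \<le> m" for l'
  proof -
    have "S_hat b kt f l' m \<le> ennreal (\<omega>hat (m - l')) * S_check b kt f m"
      using assms(11) that by (simp add: integrand_cone_def)
    also have "\<dots> \<le> ennreal (\<omega>hat (m - l')) * ennreal (\<beta> * S)"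
      by (intro mult_left_mono check) simp
    finally show ?thesis using assms(7) nn by (simp add: ennreal_mult)
  qed
  \<comment> \<open>The alias sums could be infinite a priori, so the estimate stays in
    \<open>ennreal\<close> until \<open>hat\<close> supplies a finite bound.\<close>
  have "ennreal S \<le> ennreal T + S_hat b kt f l m"
  proof -
    have "ennreal S = (\<Sum>\<kappa>\<in>{b ^ l div b..<b ^ l}. ennreal (cmod (walsh_coeff b f (kt \<kappa>))))"
      by (simp add: S_def S_sum_def)
    also have "\<dots> \<le> (\<Sum>\<kappa>\<in>{b ^ l div b..<b ^ l}. ennreal (cmod (discrete_walsh b z \<Delta> f m (kt \<kappa>)))
        + (\<Sum>n. ennreal (cmod (walsh_coeff b f (kt (\<kappa> + Suc n * b ^ m))))))"
    proof (rule sum_mono)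
      fix \<kappa> assume "\<kappa> \<in> {b ^ l div b..<b ^ l}"
      moreover have "b ^ l \<le> b ^ m" using assms(14) b by (intro power_increasing) auto
      ultimately have "\<kappa> < b ^ m" by simp
      have "ennreal (cmod (walsh_coeff b f (kt \<kappa>)))
          \<le> ennreal (cmod (discrete_walsh b z \<Delta> f m (kt \<kappa>))
              + cmod (discrete_walsh b z \<Delta> f m (kt \<kappa>) - walsh_coeff b f (kt \<kappa>)))"
        by (intro ennreal_leI) norm
      also have "\<dots> \<le> ennreal (cmod (discrete_walsh b z \<Delta> f m (kt \<kappa>)))
          + (\<Sum>n. ennreal (cmod (walsh_coeff b f (kt (\<kappa> + Suc n * b ^ m)))))"
        using aliases[OF \<open>\<kappa> < b ^ m\<close>] by (simp add: add_left_mono del: mult_Suc)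
      finally show "ennreal (cmod (walsh_coeff b f (kt \<kappa>)))
          \<le> ennreal (cmod (discrete_walsh b z \<Delta> f m (kt \<kappa>)))
          + (\<Sum>n. ennreal (cmod (walsh_coeff b f (kt (\<kappa> + Suc n * b ^ m)))))" .
    qed
    also have "\<dots> = ennreal T + S_hat b kt f l m"
      by (simp add: T_def S_tilde_def S_hat_def sum.distrib del: mult_Suc)
    finally show ?thesis .
  qed
  also have "\<dots> \<le> ennreal T + ennreal (\<alpha> * (\<beta> * S))"
    using hat[OF assms(14)] by (simp add: \<alpha>_def add_left_mono)
  also have "\<dots> = ennreal (T + \<alpha> * (\<beta> * S))"
    using nn by simp
  finally have "S \<le> T + \<alpha> * (\<beta> * S)"
    by (subst (asm) ennreal_le_iff) (use nn in auto)
  \<comment> \<open>The multiple of \<open>S\<close> can be absorbed on the left because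
    \<open>S\<close> is a real number and \<open>1 - \<alpha> * \<beta>\<close> is positive.\<close>
  then have S: "S \<le> T / (1 - \<alpha> * \<beta>)"
    using assms(15) by (simp add: \<alpha>_def \<beta>_def pos_le_divide_eq algebra_simps)
  \<comment> \<open>The zero wavenumber has the trivial character, so its true and discrete
    coefficients are the integral and the cubature value.\<close>
  have "ennreal (cmod ((LINT x|lebesgue_on half_open_cube. f x) - cubature b z \<Delta> f m)) =
      ennreal (cmod (discrete_walsh b z \<Delta> f m (kt 0) - walsh_coeff b f (kt 0)))"
    by (simp add: kt0 discrete_walsh_def walsh_coeff_def cubature_def norm_minus_commute)
  also have "\<dots> \<le> S_hat b kt f 0 m"
    using aliases[OF b0] by (simp only: S_hat_def block0 sum.insert finite.emptyI empty_iff not_False_eq_True sum.empty add_0_right)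
  also have "\<dots> \<le> ennreal (\<omega>hat m * (\<beta> * S))" using hat[OF le0] by (simp only: minus_nat.diff_0)
  finally have "cmod ((LINT x|lebesgue_on half_open_cube. f x) - cubature b z \<Delta> f m) \<le> \<omega>hat m * (\<beta> * S)"
    using nn by (simp add: ennreal_le_iff)
  also have "\<dots> \<le> \<omega>hat m * (\<beta> * (T / (1 - \<alpha> * \<beta>)))"
    using S nn by (intro mult_left_mono) auto
  finally show ?thesis by (simp add: \<alpha>_def \<beta>_def T_def mult_ac)
qed

end
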